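(* For all $n\geq 1$, $c_n(12\text{-}1)=c_n(12\text{-}3)=2^{n-1}$, $c_n(12\text{-}2)=\binom{n}{2}+1$ and $c_n(23\text{-}1)=F_{2n-1}$.
   Context: A Catalan word of length $n\ge 1$ is a sequence $\pi=\pi_1\cdots\pi_n$ of positive integers with $\pi_1=1$ and $\pi_{i+1}\le \pi_i+1$ for $1\le i\le n-1$; $\mathcal{C}_n$ is the set of these. Two sequences of the same length are order-isomorphic if their corresponding pairs of entries stand in the same relation ($<$, $>$ or $=$). A word $\pi$ contains the vincular pattern $xy\text{-}z$ if there are indices $i,j$ with $i+1<j\le n$ such that $\pi_i\pi_{i+1}\pi_j$ is order-isomorphic to $xyz$ (the first two letters must be adjacent in $\pi$); otherwise $\pi$ avoids it. $c_n(\tau)$ denotes the number of members of $\mathcal{C}_n$ avoiding $\tau$. $F_n$ is the Fibonacci sequence: $F_0=0$, $F_1=1$, $F_n=F_{n-1}+F_{n-2}$ for $n\ge 2$. *)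

theory Defs
  imports "HOL-Number_Theory.Fib"
begin

text \<open>Words are lists of natural numbers. Lists are indexed from 0, so the letter written
  \<open>\<pi>\<^sub>i\<close> with \<open>1 \<le> i \<le> n\<close> is \<open>w ! (i - 1)\<close>.\<close>

definition catalan_words :: "nat \<Rightarrow> nat list set" where
  "catalan_words n =
     {w. length w = n \<and> (\<forall>a \<in> set w. 1 \<le> a) \<and> w ! 0 = 1 \<and>
         (\<forall>i. i + 1 < n \<longrightarrow> w ! (i + 1) \<le> w ! i + 1)}"

definition order_isomorphic :: "'a::linorder list \<Rightarrow> 'b::linorder list \<Rightarrow> bool" where
  "order_isomorphic u v \<longleftrightarrow> length u = length v \<and>
     (\<forall>a < length u. \<forall>b < length u.
        (u ! a < u ! b \<longleftrightarrow> v ! a < v ! b) \<and>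
        (u ! a > u ! b \<longleftrightarrow> v ! a > v ! b) \<and>
        (u ! a = u ! b \<longleftrightarrow> v ! a = v ! b))"

text \<open>The vincular pattern \<open>xy-z\<close> is given as the list \<open>[x, y, z]\<close>.\<close>

definition contains_vincular :: "nat list \<Rightarrow> nat list \<Rightarrow> bool" where
  "contains_vincular w \<tau> \<longleftrightarrow>
     (\<exists>i j. i + 1 < j \<and> j < length w \<and> order_isomorphic [w ! i, w ! (i + 1), w ! j] \<tau>)"

definition avoiders :: "nat \<Rightarrow> nat list \<Rightarrow> nat list set" where
  "avoiders n \<tau> = {w \<in> catalan_words n. \<not> contains_vincular w \<tau>}"

definition c :: "nat \<Rightarrow> nat list \<Rightarrow> nat" where
  "c n \<tau> = card (avoiders n \<tau>)"

end

theory Submission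
  imports Defs
begin

text \<open>
  Build the words one letter at a time, from left to right. Write \<open>M\<close> for the largest letter of
  a nonempty Catalan word \<open>w\<close>. The word starts at \<open>1\<close> and never climbs by more than one, so the
  bottoms of its ascents are exactly \<open>1, \<dots>, M - 1\<close> (\<open>ascent_bottoms\<close>). All four patterns begin
  with an ascent, hence whether an avoider \<open>w\<close> may be extended by \<open>z\<close> depends only on
  \<open>M\<close> and on the last letter \<open>l\<close> (\<open>avoiders_snoc\<close>). With \<open>1 \<le> z \<le> l + 1\<close>, the conditions are

    \<^item> for \<open>12-1\<close>: \<open>z \<ge> M\<close>;
    \<^item> for \<open>12-3\<close>: \<open>M = 1\<close> or \<open>z \<le> 2\<close>;
    \<^item> for \<open>12-2\<close>: \<open>z = 1\<close> or \<open>z > M\<close>;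
    \<^item> for \<open>23-1\<close>: \<open>z \<ge> M - 1\<close>.

  Call a word topped if \<open>l = M\<close>, and flat if \<open>M = 1\<close>; there is one flat word of each length.
  For \<open>12-1\<close> every avoider is topped and has the two extensions \<open>M, M + 1\<close>; for \<open>12-3\<close> the
  extensions are always \<open>1, 2\<close>. Both counts therefore double at each step. For the other two
  patterns let \<open>T\<close> be the number of avoiders and \<open>U\<close> the number of topped ones. For \<open>12-2\<close>
  the extensions are \<open>1\<close> and, for topped words, \<open>M + 1\<close>; extending by \<open>1\<close> gives a topped word
  only from the flat one. So \<open>(T, U)\<close> becomes \<open>(T + U, U + 1)\<close>. For \<open>23-1\<close> the extensions are
  \<open>M - 1\<close> (except for the flat word), \<open>M\<close>, and, for topped words, \<open>M + 1\<close>, and the last two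
  kinds give topped words. So \<open>(T, U)\<close> becomes \<open>(2 T + U - 1, T + U)\<close>, which is solved by
  \<open>T = F\<^sub>2\<^sub>n\<^sub>-\<^sub>1\<close> and \<open>U = F\<^sub>2\<^sub>n\<^sub>-\<^sub>2 + 1\<close>.
\<close>

section \<open>Catalan words built letter by letter\<close>

lemma catalan_words_snoc:
  assumes "n \<ge> 1"
  shows "w @ [z] \<in> catalan_words (Suc n) \<longleftrightarrow>
         w \<in> catalan_words n \<and> 1 \<le> z \<and> z \<le> last w + 1"
proof (cases "length w = n")
  case False
  then show ?thesis by (auto simp: catalan_words_def)
next
  case True
  with assms have ne: "w \<noteq> []" by auto
  have "(\<forall>i. i + 1 < Suc n \<longrightarrow> (w @ [z]) ! (i + 1) \<le> (w @ [z]) ! i + 1) \<longleftrightarrow>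
        (\<forall>i. i + 1 < n \<longrightarrow> w ! (i + 1) \<le> w ! i + 1) \<and> z \<le> last w + 1" (is "?L \<longleftrightarrow> ?R")
  proof
    assume L: ?L
    have "w ! (i + 1) \<le> w ! i + 1" if "i + 1 < n" for i
      using L[rule_format, of i] that True by (simp add: nth_append)
    moreover have "z \<le> last w + 1"
      using L[rule_format, of "n - 1"] assms True ne by (simp add: nth_append last_conv_nth)
    ultimately show ?R by blast
  next
    assume R: ?R
    show ?L
    proof (intro allI impI)
      fix i assume "i + 1 < Suc n"
      then consider "i + 1 < n" | "i = n - 1" using assms by linarith
      then show "(w @ [z]) ! (i + 1) \<le> (w @ [z]) ! i + 1"
        using R assms True ne by cases (simp_all add: nth_append last_conv_nth)
    qed
  qed
  then show ?thesis
    using True assms by (auto simp: catalan_words_def nth_append)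
qed

lemma catalan_words_nonempty: "w \<in> catalan_words n \<Longrightarrow> n \<ge> 1 \<Longrightarrow> w \<noteq> []"
  by (auto simp: catalan_words_def)

lemma last_le_Max_set: "w \<noteq> [] \<Longrightarrow> last w \<le> Max (set w)" for w :: "nat list"
  by simp

lemma catalan_words_last_ge_1: "w \<in> catalan_words n \<Longrightarrow> n \<ge> 1 \<Longrightarrow> 1 \<le> last w"
  using catalan_words_nonempty[of w n] by (auto simp: catalan_words_def)

text \<open>A word that starts at \<open>1\<close> and climbs by at most one must step from \<open>x\<close> to \<open>x + 1\<close> when it
  first exceeds \<open>x\<close>.\<close>

lemma ascent_bottoms:
  assumes "w \<in> catalan_words n" "n \<ge> 1"
  shows "(\<exists>i. i + 1 < n \<and> w ! i = x \<and> w ! (i + 1) = x + 1) \<longleftrightarrow> 1 \<le> x \<and> x < Max (set w)"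
proof
  assume "\<exists>i. i + 1 < n \<and> w ! i = x \<and> w ! (i + 1) = x + 1"
  then obtain i where i: "i + 1 < n" "w ! i = x" "w ! (i + 1) = x + 1" by blast
  have len: "length w = n" using assms by (simp add: catalan_words_def)
  have "1 \<le> x" using assms i len by (force simp: catalan_words_def)
  moreover have "w ! (i + 1) \<le> Max (set w)" using i len by (metis List.finite_set Max_ge nth_mem)
  ultimately show "1 \<le> x \<and> x < Max (set w)" using i by simp
next
  assume x: "1 \<le> x \<and> x < Max (set w)"
  have len: "length w = n" and w0: "w ! 0 = 1"
    and climb: "\<And>i. i + 1 < n \<Longrightarrow> w ! (i + 1) \<le> w ! i + 1"
    using assms by (simp_all add: catalan_words_def)
  have "Max (set w) \<in> set w" using len assms by (intro Max_in) auto
  then obtain k where k: "k < n" "x < w ! k" using x len by (metis in_set_conv_nth)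
  define j where "j = (LEAST k. k < n \<and> x < w ! k)"
  have j: "j < n" "x < w ! j" unfolding j_def
    using LeastI[of "\<lambda>k. k < n \<and> x < w ! k" k] k by blast+
  have "j \<noteq> 0" using j x w0 by (metis not_less)
  then obtain i where ji: "j = i + 1" by (metis Suc_eq_plus1 not0_implies_Suc)
  then have "\<not> x < w ! i"
    using not_less_Least[of i "\<lambda>k. k < n \<and> x < w ! k"] j by (auto simp: j_def)
  then show "\<exists>i. i + 1 < n \<and> w ! i = x \<and> w ! (i + 1) = x + 1"
    using climb[of i] j ji by (intro exI[of _ i]) auto
qed

section \<open>Extending an avoider by one letter\<close>

lemma order_isomorphic_triple:
  "order_isomorphic [x, y, z] [a, b, d] \<longleftrightarrow>
     (x < y \<longleftrightarrow> a < b) \<and> (y < x \<longleftrightarrow> b < a) \<and>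
     (x < z \<longleftrightarrow> a < d) \<and> (z < x \<longleftrightarrow> d < a) \<and>
     (y < z \<longleftrightarrow> b < d) \<and> (z < y \<longleftrightarrow> d < b)"
  for x y z :: "'a::linorder" and a b d :: "'b::linorder"
  by (auto simp: order_isomorphic_def All_less_Suc numeral_3_eq_3 less_Suc_eq)

text \<open>The bound variable \<open>x\<close> runs over the bottoms of the ascents of \<open>w\<close>: a letter \<open>z\<close> is excluded
  when it completes one of these ascents to an occurrence of the pattern.\<close>

definition extensions :: "nat list \<Rightarrow> nat list \<Rightarrow> nat set" where
  "extensions \<tau> w = {z. 1 \<le> z \<and> z \<le> last w + 1 \<and>
     (\<forall>x. 1 \<le> x \<and> x < Max (set w) \<longrightarrow> \<not> order_isomorphic [x, x + 1, z] \<tau>)}"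

text \<open>A new last letter can only be the last letter of an occurrence. The first two letters of the
  occurrence rise because \<open>a < b\<close>, and a rise between adjacent letters of a Catalan word is by
  exactly one, so they form one of the ascents described by \<open>ascent_bottoms\<close>.\<close>

lemma contains_vincular_snoc:
  assumes w: "w \<in> catalan_words n" and n: "n \<ge> 1" and "a < b"
  shows "contains_vincular (w @ [z]) [a, b, d] \<longleftrightarrow> contains_vincular w [a, b, d] \<or>
         (\<exists>x. 1 \<le> x \<and> x < Max (set w) \<and> order_isomorphic [x, x + 1, z] [a, b, d])"
proof -
  have len: "length w = n" and climb: "\<And>i. i + 1 < n \<Longrightarrow> w ! (i + 1) \<le> w ! i + 1"
    using w by (simp_all add: catalan_words_def)
  let ?iso = "\<lambda>u. order_isomorphic u [a, b, d]"
  have "contains_vincular (w @ [z]) [a, b, d] \<longleftrightarrow>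
      contains_vincular w [a, b, d] \<or> (\<exists>i. i + 1 < n \<and> ?iso [w ! i, w ! (i + 1), z])"
    (is "?L \<longleftrightarrow> ?R")
  proof
    assume ?L
    then obtain i j where ij: "i + 1 < j" "j < Suc n"
      "?iso [(w @ [z]) ! i, (w @ [z]) ! (i + 1), (w @ [z]) ! j]"
      by (auto simp: contains_vincular_def len)
    show ?R
    proof (cases "j = n")
      case True
      then show ?thesis using ij by (auto simp: nth_append len)
    next
      case False
      then have "j < n" using ij by simp
      then have "contains_vincular w [a, b, d]"
        unfolding contains_vincular_def using ij
        by (intro exI[of _ i] exI[of _ j]) (simp add: nth_append len)
      then show ?thesis ..
    qed
  next
    assume ?R
    then show ?L
    proof
      assume "contains_vincular w [a, b, d]"
      then obtain i j where ij: "i + 1 < j" "j < n" "?iso [w ! i, w ! (i + 1), w ! j]"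
        by (auto simp: contains_vincular_def len)
      then show ?L
        unfolding contains_vincular_def
        by (intro exI[of _ i] exI[of _ j]) (simp add: nth_append len)
    next
      assume "\<exists>i. i + 1 < n \<and> ?iso [w ! i, w ! (i + 1), z]"
      then obtain i where "i + 1 < n" "?iso [w ! i, w ! (i + 1), z]" by blast
      then show ?L
        unfolding contains_vincular_def
        by (intro exI[of _ i] exI[of _ n]) (simp add: nth_append len)
    qed
  qed
  also have "(\<exists>i. i + 1 < n \<and> ?iso [w ! i, w ! (i + 1), z]) \<longleftrightarrow>
      (\<exists>x. (\<exists>i. i + 1 < n \<and> w ! i = x \<and> w ! (i + 1) = x + 1) \<and> ?iso [x, x + 1, z])"
    (is "?L' \<longleftrightarrow> ?R'")
  proof
    assume ?L'
    then obtain i where i: "i + 1 < n" "?iso [w ! i, w ! (i + 1), z]" by blast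
    then have "w ! i < w ! (i + 1)" using \<open>a < b\<close> by (simp add: order_isomorphic_triple)
    then have "w ! (i + 1) = w ! i + 1" using climb[OF i(1)] by simp
    then show ?R' using i by metis
  qed metis
  finally show ?thesis
    by (simp only: ascent_bottoms[OF w n] conj_assoc)
qed

lemma avoiders_snoc:
  assumes "n \<ge> 1" "a < b"
  shows "w @ [z] \<in> avoiders (Suc n) [a, b, d] \<longleftrightarrow>
         w \<in> avoiders n [a, b, d] \<and> z \<in> extensions [a, b, d] w"
  unfolding avoiders_def extensions_def mem_Collect_eq catalan_words_snoc[OF assms(1)]
  using contains_vincular_snoc[OF _ assms] by blast

lemma avoiders_1: "avoiders (Suc 0) \<tau> = {[1]}"
  by (auto simp: avoiders_def catalan_words_def contains_vincular_def length_Suc_conv)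

lemma avoiders_SucE:
  assumes "w \<in> avoiders (Suc n) [a, b, d]" "n \<ge> 1" "a < b"
  obtains v z where "w = v @ [z]" "v \<in> avoiders n [a, b, d]" "z \<in> extensions [a, b, d] v"
proof -
  have "w \<noteq> []" using assms(1) by (auto simp: avoiders_def catalan_words_def)
  then have "butlast w @ [last w] = w" by simp
  then show thesis using that avoiders_snoc[OF assms(2,3)] assms(1) by metis
qed

lemma finite_extensions: "finite (extensions \<tau> w)"
  by (rule finite_subset[of _ "{..last w + 1}"]) (auto simp: extensions_def)

lemma avoiders_Suc_conv_image:
  assumes "n \<ge> 1" "a < b"
  shows "{w \<in> avoiders (Suc n) [a, b, d]. P w} =
         (\<lambda>(v, z). v @ [z]) ` (SIGMA v:avoiders n [a, b, d].
            {z \<in> extensions [a, b, d] v. P (v @ [z])})"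
  by (auto simp: image_iff avoiders_snoc[OF assms] elim: avoiders_SucE[OF _ assms])

lemma finite_avoiders:
  assumes "n \<ge> 1" "a < b"
  shows "finite (avoiders n [a, b, d])"
  using assms(1)
proof (induction n rule: dec_induct)
  case base
  then show ?case by (simp add: avoiders_1)
next
  case (step n)
  then show ?case
    using avoiders_Suc_conv_image[of n a b d "\<lambda>_. True"] assms(2)
    by (auto intro!: finite_SigmaI simp: finite_extensions)
qed

lemma card_avoiders_Suc:
  assumes "n \<ge> 1" "a < b"
  shows "card {w \<in> avoiders (Suc n) [a, b, d]. P w} =
         (\<Sum>v\<in>avoiders n [a, b, d]. card {z \<in> extensions [a, b, d] v. P (v @ [z])})"
  unfolding avoiders_Suc_conv_image[OF assms]
  using finite_avoiders[OF assms] finite_extensions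
  by (subst card_image) (auto simp: inj_on_def)

section \<open>Topped and flat words\<close>

text \<open>The largest letter of \<open>w\<close> and its last letter determine the extensions of \<open>w\<close>. For
  the four patterns, how many extensions there are, and how many of them give topped words,
  depends only on whether \<open>w\<close> is topped and whether it is flat.\<close>

definition topped :: "nat list \<Rightarrow> bool" where
  "topped w \<longleftrightarrow> last w = Max (set w)"

definition flat :: "nat list \<Rightarrow> bool" where
  "flat w \<longleftrightarrow> Max (set w) = 1"

lemma Max_set_snoc: "w \<noteq> [] \<Longrightarrow> Max (set (w @ [z])) = max (Max (set w)) z"
  by (simp add: max.commute)

lemma topped_snoc: "w \<noteq> [] \<Longrightarrow> topped (w @ [z]) \<longleftrightarrow> Max (set w) \<le> z"
  unfolding topped_def Max_set_snoc by (simp add: max_def del: Max.bounded_iff)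

lemma avoidersD:
  assumes "w \<in> avoiders n \<tau>" "n \<ge> 1"
  shows "w \<noteq> []" "1 \<le> last w" "last w \<le> Max (set w)"
  using assms catalan_words_nonempty catalan_words_last_ge_1 last_le_Max_set
  by (auto simp: avoiders_def)

lemma card_filter_avoiders:
  assumes "n \<ge> 1" "a < b"
  shows "(\<Sum>w\<in>avoiders n [a, b, d]. of_bool (P w)) = card {w \<in> avoiders n [a, b, d]. P w}"
  using finite_avoiders[OF assms] by (simp add: sum.If_cases of_bool_def Int_def)

text \<open>A flat word has no ascents, so it is an avoider: there is exactly one of each length, since
  its only flat extension is by the letter \<open>1\<close>.\<close>

lemma card_flat_avoiders:
  assumes "n \<ge> 1" "a < b"
  shows "card {w \<in> avoiders n [a, b, d]. flat w} = 1"
  using assms(1)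
proof (induction n rule: dec_induct)
  case base
  have "{w \<in> avoiders 1 [a, b, d]. flat w} = {[1]}" by (auto simp: avoiders_1 flat_def)
  then show ?case by simp
next
  case (step n)
  have "card {z \<in> extensions [a, b, d] w. flat (w @ [z])} = of_bool (flat w)"
    if "w \<in> avoiders n [a, b, d]" for w
  proof -
    note w = avoidersD[OF that step(1)]
    have "flat (w @ [z]) \<longleftrightarrow> flat w \<and> z = 1" if "1 \<le> z" for z
      unfolding flat_def Max_set_snoc[OF w(1)] using w(2,3) that by (simp add: max_def) linarith
    then have "{z \<in> extensions [a, b, d] w. flat (w @ [z])} = (if flat w then {1} else {})"
      using w(2) by (auto simp: extensions_def flat_def)
    then show ?thesis by simp
  qed
  then show ?case
    using step assms(2) by (simp add: card_avoiders_Suc card_filter_avoiders cong: sum.cong)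
qed

section \<open>The extensions for each pattern\<close>

lemma extensions_121:
  "1 \<le> last w \<Longrightarrow> extensions [1, 2, 1] w = {Max (set w)..last w + 1} \<inter> {1..}"
  by (auto simp: extensions_def order_isomorphic_triple not_less)

text \<open>The bottom \<open>1\<close> of an ascent gives the strongest restriction, so all that matters is whether
  \<open>w\<close> has an ascent at all. If it has none, \<open>z \<le> 2\<close> follows from \<open>z \<le> l + 1\<close>.\<close>

lemma extensions_123:
  assumes "1 \<le> last w" "last w \<le> Max (set w)"
  shows "extensions [1, 2, 3] w = {1, 2}"
proof (cases "Max (set w) = 1")
  case True
  then show ?thesis using assms by (auto simp: extensions_def)
next
  case False
  then have "1 < Max (set w)" using assms by simp
  then show ?thesis using assms
    by (force simp: extensions_def order_isomorphic_triple)
qed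

lemma extensions_122:
  assumes "1 \<le> last w" "last w \<le> Max (set w)"
  shows "extensions [1, 2, 2] w =
         insert 1 (if topped w then {Max (set w) + 1} else {})"
proof -
  have "z \<in> extensions [1, 2, 2] w \<longleftrightarrow> z = 1 \<or> topped w \<and> z = Max (set w) + 1" for z
  proof -
    have "(\<forall>x. 1 \<le> x \<and> x < Max (set w) \<longrightarrow> \<not> order_isomorphic [x, x + 1, z] [1, 2, 2::nat]) \<longleftrightarrow>
          (\<forall>x. 1 \<le> x \<and> x < Max (set w) \<longrightarrow> z \<noteq> x + 1)"
      by (auto simp: order_isomorphic_triple)
    also have "\<dots> \<longleftrightarrow> \<not> (2 \<le> z \<and> z \<le> Max (set w))"
      by (cases z) auto
    finally have "z \<in> extensions [1, 2, 2] w \<longleftrightarrow>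
        1 \<le> z \<and> z \<le> last w + 1 \<and> \<not> (2 \<le> z \<and> z \<le> Max (set w))"
      unfolding extensions_def by blast
    then show ?thesis using assms unfolding topped_def by linarith
  qed
  then show ?thesis by (auto split: if_splits)
qed

lemma extensions_231:
  assumes "1 \<le> last w" "last w \<le> Max (set w)"
  shows "extensions [2, 3, 1] w = {max 1 (Max (set w) - 1)..last w + 1}"
proof -
  have "z \<in> extensions [2, 3, 1] w \<longleftrightarrow> z \<in> {max 1 (Max (set w) - 1)..last w + 1}" for z
  proof -
    have "(\<forall>x. 1 \<le> x \<and> x < Max (set w) \<longrightarrow> \<not> order_isomorphic [x, x + 1, z] [2, 3, 1::nat]) \<longleftrightarrow>
          (\<forall>x. 1 \<le> x \<and> x < Max (set w) \<longrightarrow> x \<le> z)"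
      by (auto simp: order_isomorphic_triple)
    also have "\<dots> \<longleftrightarrow> Max (set w) - 1 \<le> z" if "1 \<le> z"
    proof
      assume "\<forall>x. 1 \<le> x \<and> x < Max (set w) \<longrightarrow> x \<le> z"
      from this[rule_format, of "Max (set w) - 1"] that show "Max (set w) - 1 \<le> z" by linarith
    qed auto
    finally show ?thesis unfolding extensions_def atLeastAtMost_iff max.bounded_iff by blast
  qed
  then show ?thesis by blast
qed

text \<open>An avoider of \<open>23-1\<close> never drops more than one below its maximum: if \<open>M > 1\<close>, then
  the first occurrence of \<open>M\<close> is the top of an ascent from \<open>M - 1\<close>, so no smaller letter than
  \<open>M - 1\<close> can follow.\<close>

lemma Max_le_last_avoiders_231:
  assumes "w \<in> avoiders n [2, 3, 1]" "n \<ge> 1"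
  shows "Max (set w) \<le> last w + 1"
proof (cases n)
  case 0
  then show ?thesis using assms by simp
next
  case (Suc m)
  show ?thesis
  proof (cases "m = 0")
    case True
    then show ?thesis using assms Suc by (auto simp: avoiders_1)
  next
    case False
    then obtain v z where v: "w = v @ [z]" "v \<in> avoiders m [2, 3, 1]"
        "z \<in> extensions [2, 3, 1] v"
      using avoiders_SucE[of w m 2 3 1] assms Suc by auto
    have m: "m \<ge> 1" using False by simp
    note v' = avoidersD[OF v(2) m]
    show ?thesis
      using v(3)
      unfolding v(1) Max_set_snoc[OF v'(1)] last_snoc extensions_231[OF v'(2,3)]
        atLeastAtMost_iff max.bounded_iff by linarith
  qed
qed

section \<open>The four counts\<close>

text \<open>A letter \<open>x\<close> below the maximum of the preceding letters would repeat the
  bottom of an ascent from \<open>x\<close> to \<open>x + 1\<close>.\<close>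

lemma topped_avoiders_121:
  assumes "w \<in> avoiders n [1, 2, 1]" "n \<ge> 1"
  shows "topped w"
proof (cases "n = 1")
  case True
  then show ?thesis using assms by (auto simp: avoiders_1 topped_def)
next
  case False
  then obtain m where m: "n = Suc m" "m \<ge> 1" using assms(2) by (cases n) auto
  then obtain v z where v: "w = v @ [z]" "v \<in> avoiders m [1, 2, 1]"
      "z \<in> extensions [1, 2, 1] v"
    using avoiders_SucE[of w m 1 2 1] assms by auto
  note v' = avoidersD[OF v(2) m(2)]
  show ?thesis
    using v(3) unfolding v(1) topped_snoc[OF v'(1)] extensions_121[OF v'(2)]
    by (simp only: Int_iff atLeastAtMost_iff)
qed

lemma card_avoiders_121: "n \<ge> 1 \<Longrightarrow> card (avoiders n [1, 2, 1]) = 2 ^ (n - 1)"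
proof (induction n rule: dec_induct)
  case base
  then show ?case by (simp add: avoiders_1)
next
  case (step n)
  have "card (extensions [1, 2, 1] w) = 2" if "w \<in> avoiders n [1, 2, 1]" for w
  proof -
    note w = avoidersD[OF that step(1)]
    have "extensions [1, 2, 1] w = {last w, last w + 1}"
      using w topped_avoiders_121[OF that step(1)]
      unfolding extensions_121[OF w(2)] topped_def by (auto simp del: Max.bounded_iff)
    then show ?thesis by simp
  qed
  then show ?case
    using step card_avoiders_Suc[of n 1 2 1 "\<lambda>_. True"]
    by (cases n) (simp_all cong: sum.cong)
qed

lemma card_avoiders_123: "n \<ge> 1 \<Longrightarrow> card (avoiders n [1, 2, 3]) = 2 ^ (n - 1)"
proof (induction n rule: dec_induct)
  case base
  then show ?case by (simp add: avoiders_1)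
next
  case (step n)
  have "card (extensions [1, 2, 3] w) = 2" if "w \<in> avoiders n [1, 2, 3]" for w
    unfolding extensions_123[OF avoidersD(2,3)[OF that step(1)]] by simp
  then show ?case
    using step card_avoiders_Suc[of n 1 2 3 "\<lambda>_. True"]
    by (cases n) (simp_all cong: sum.cong)
qed

text \<open>The induction needs the number of topped avoiders as well. They are the words
  \<open>1\<dots>1 2 3 \<dots> m\<close>, one for each number of leading ones.\<close>

lemma card_avoiders_122:
  "n \<ge> 1 \<Longrightarrow> card (avoiders n [1, 2, 2]) = (n choose 2) + 1 \<and>
              card {w \<in> avoiders n [1, 2, 2]. topped w} = n"
proof (induction n rule: dec_induct)
  case base
  have "{w \<in> avoiders 1 [1, 2, 2]. topped w} = {[1]}" by (auto simp: avoiders_1 topped_def)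
  then show ?case by (simp add: avoiders_1)
next
  case (step n)
  let ?A = "avoiders n [1, 2, 2]"
  have all: "card (extensions [1, 2, 2] w) = 1 + of_bool (topped w)"
    and top: "card {z \<in> extensions [1, 2, 2] w. topped (w @ [z])} =
              of_bool (flat w) + of_bool (topped w)" if "w \<in> ?A" for w
  proof -
    note w = avoidersD[OF that step(1)]
    have M: "1 \<le> Max (set w)" using w(2,3) by (rule order_trans)
    show "card (extensions [1, 2, 2] w) = 1 + of_bool (topped w)"
      unfolding extensions_122[OF w(2,3)] using M by auto
    have "{z \<in> extensions [1, 2, 2] w. topped (w @ [z])} =
        (if flat w then {1} else {}) \<union> (if topped w then {Max (set w) + 1} else {})"
      using M unfolding extensions_122[OF w(2,3)] topped_snoc[OF w(1)]
      by (auto simp: flat_def simp del: Max.bounded_iff split: if_splits)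
    then show "card {z \<in> extensions [1, 2, 2] w. topped (w @ [z])} =
              of_bool (flat w) + of_bool (topped w)"
      using M by (auto simp: flat_def)
  qed
  have "card (avoiders (Suc n) [1, 2, 2]) = (\<Sum>w\<in>?A. 1 + of_bool (topped w))"
    using card_avoiders_Suc[of n 1 2 2 "\<lambda>_. True"] all step(1) by (simp cong: sum.cong)
  also have "\<dots> = card ?A + card {w \<in> ?A. topped w}"
    unfolding sum.distrib using step(1) by (simp add: card_filter_avoiders)
  finally have T: "card (avoiders (Suc n) [1, 2, 2]) = card ?A + card {w \<in> ?A. topped w}" .
  have "card {w \<in> avoiders (Suc n) [1, 2, 2]. topped w} =
      (\<Sum>w\<in>?A. of_bool (flat w) + of_bool (topped w))"
    using card_avoiders_Suc[of n 1 2 2 topped] top step(1) by (simp cong: sum.cong)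
  also have "\<dots> = 1 + card {w \<in> ?A. topped w}"
    unfolding sum.distrib using step(1) by (simp add: card_filter_avoiders card_flat_avoiders)
  finally have U: "card {w \<in> avoiders (Suc n) [1, 2, 2]. topped w} =
      1 + card {w \<in> ?A. topped w}" .
  have "Suc n choose 2 = (n choose 2) + n"
    using binomial_Suc_Suc[of n 1] by (simp add: numeral_2_eq_2)
  then show ?case using T U step by simp
qed

text \<open>With \<open>T\<close> and \<open>U\<close> as in the introduction, the recurrences are \<open>T' + 1 = 2 T + U\<close> and
  \<open>U' = T + U\<close>: up to the shift by one in \<open>U\<close>, which the flat word causes, this is two steps of
  the Fibonacci recurrence.\<close>

lemma card_avoiders_231:
  "n \<ge> 1 \<Longrightarrow> card (avoiders n [2, 3, 1]) = fib (2 * n - 1) \<and>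
              card {w \<in> avoiders n [2, 3, 1]. topped w} = fib (2 * n - 2) + 1"
proof (induction n rule: dec_induct)
  case base
  have "{w \<in> avoiders 1 [2, 3, 1]. topped w} = {[1]}" by (auto simp: avoiders_1 topped_def)
  then show ?case by (simp add: avoiders_1)
next
  case (step n)
  let ?A = "avoiders n [2, 3, 1]"
  \<comment> \<open>The summand \<open>of_bool (flat w)\<close> stands on the left to avoid truncated subtraction.\<close>
  have all: "card (extensions [2, 3, 1] w) + of_bool (flat w) = 2 + of_bool (topped w)"
    and top: "card {z \<in> extensions [2, 3, 1] w. topped (w @ [z])} = 1 + of_bool (topped w)"
    if "w \<in> ?A" for w
  proof -
    note w = avoidersD[OF that step(1)] Max_le_last_avoiders_231[OF that step(1)]
    have "card {max 1 (M - 1)..l + 1} + of_bool (M = 1) = 2 + of_bool (l = M)"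
      if "1 \<le> l" "l \<le> M" "M \<le> l + 1" for l M :: nat
      using that by (auto simp: max_def)
    from this[OF w(2-4)]
    show "card (extensions [2, 3, 1] w) + of_bool (flat w) = 2 + of_bool (topped w)"
      unfolding extensions_231[OF w(2,3)] flat_def topped_def .
    have "{z \<in> extensions [2, 3, 1] w. topped (w @ [z])} = {Max (set w)..last w + 1}"
      unfolding extensions_231[OF w(2,3)] topped_snoc[OF w(1)] using w(2,3) by auto
    moreover have "card {M..l + 1} = 1 + of_bool (l = M)" if "l \<le> M" "M \<le> l + 1" for l M :: nat
      using that by auto
    from this[OF w(3,4)] have "card {Max (set w)..last w + 1} = 1 + of_bool (topped w)"
      unfolding topped_def .
    ultimately show "card {z \<in> extensions [2, 3, 1] w. topped (w @ [z])} = 1 + of_bool (topped w)"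
      by (rule ssubst)
  qed
  have "card (avoiders (Suc n) [2, 3, 1]) + 1 =
      (\<Sum>w\<in>?A. card (extensions [2, 3, 1] w) + of_bool (flat w))"
    using card_avoiders_Suc[of n 2 3 1 "\<lambda>_. True"] step(1)
    unfolding sum.distrib by (simp add: card_filter_avoiders card_flat_avoiders)
  also have "\<dots> = (\<Sum>w\<in>?A. 2 + of_bool (topped w))"
    using all by (simp cong: sum.cong)
  also have "\<dots> = 2 * card ?A + card {w \<in> ?A. topped w}"
    unfolding sum.distrib using step(1) by (simp add: card_filter_avoiders)
  finally have T: "card (avoiders (Suc n) [2, 3, 1]) + 1 =
      2 * card ?A + card {w \<in> ?A. topped w}" .
  have "card {w \<in> avoiders (Suc n) [2, 3, 1]. topped w} = (\<Sum>w\<in>?A. 1 + of_bool (topped w))"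
    using card_avoiders_Suc[of n 2 3 1 topped] top step(1) by (simp cong: sum.cong)
  also have "\<dots> = card ?A + card {w \<in> ?A. topped w}"
    unfolding sum.distrib using step(1) by (simp add: card_filter_avoiders)
  finally have U: "card {w \<in> avoiders (Suc n) [2, 3, 1]. topped w} =
      card ?A + card {w \<in> ?A. topped w}" .
  obtain m where "n = Suc m" using step(1) by (cases n) auto
  then show ?case using T U step by simp
qed

theorem proposition3p1:
  fixes n :: nat
  assumes "n \<ge> 1"
  shows "c n [1, 2, 1] = 2 ^ (n - 1) \<and>
         c n [1, 2, 3] = 2 ^ (n - 1) \<and>
         c n [1, 2, 2] = (n choose 2) + 1 \<and>
         c n [2, 3, 1] = fib (2 * n - 1)"
  using card_avoiders_121[OF assms] card_avoiders_123[OF assms]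
    card_avoiders_122[OF assms] card_avoiders_231[OF assms]
  by (simp add: c_def)

end
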